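(* Let $A, B$ be finite non-empty alphabets, let $F$ be a finite monoid, and let $\varphi : A^{*} \to F$, $\psi : B^{*} \to F$ be epimorphisms of monoids. Then the fiber product $\Pi(\varphi,\psi) = \{(u,v) \in A^{*}\times B^{*} : \varphi(u) = \psi(v)\}$ is finitely generated (as a monoid) if and only if $|\varphi(A)| = |\psi(B)| = 1$ and $F$ is a cyclic group.
   Context: For an alphabet $A$, $A^{*}$ is the free monoid of all finite words over $A$ (including the empty word) under concatenation. "Epimorphism" means surjective homomorphism. $\Pi(\varphi,\psi)$ is a submonoid of the direct product $A^{*}\times B^{*}$. $\varphi(A)$ denotes the set of images of the letters of $A$, and similarly $\psi(B)$. *)

theory Defs
  imports "HOL-Algebra.Elementary_Groups"
begin

definition free_monoid :: "'a set \<Rightarrow> 'a list monoid" where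
  "free_monoid A = \<lparr>carrier = lists A, mult = (@), one = []\<rparr>"

lemma free_monoid_simps [simp]:
  "carrier (free_monoid A) = lists A"
  "mult (free_monoid A) = (@)"
  "one (free_monoid A) = []"
  by (simp_all add: free_monoid_def)

lemma monoid_free_monoid: "monoid (free_monoid A)"
  by (rule monoidI) auto

text \<open>The library's \<^const>\<open>hom\<close> asks for preservation of products only; a homomorphism of monoids
  must also preserve the unit.\<close>

definition monoid_epi :: "('a, 'c) monoid_scheme \<Rightarrow> ('b, 'd) monoid_scheme \<Rightarrow> ('a \<Rightarrow> 'b) set" where
  "monoid_epi M N = {h \<in> epi M N. h \<one>\<^bsub>M\<^esub> = \<one>\<^bsub>N\<^esub>}"

definition submonoid_generated_by :: "('a, 'c) monoid_scheme \<Rightarrow> 'a set \<Rightarrow> 'a set" where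
  "submonoid_generated_by M S = \<Inter>{H. submonoid H M \<and> S \<subseteq> H}"

definition finitely_generated_monoid :: "('a, 'c) monoid_scheme \<Rightarrow> bool" where
  "finitely_generated_monoid M \<longleftrightarrow>
     (\<exists>S. finite S \<and> S \<subseteq> carrier M \<and> submonoid_generated_by M S = carrier M)"

definition fiber_product ::
  "('a, 'c) monoid_scheme \<Rightarrow> ('b, 'd) monoid_scheme \<Rightarrow> ('a \<Rightarrow> 'f) \<Rightarrow> ('b \<Rightarrow> 'f) \<Rightarrow> ('a \<times> 'b) monoid" where
  "fiber_product M N \<phi> \<psi> =
     (M \<times>\<times> N)\<lparr>carrier := {(u, v) \<in> carrier M \<times> carrier N. \<phi> u = \<psi> v}\<rparr>"

lemma submonoid_fiber_product:
  assumes "monoid M" "monoid N" "\<phi> \<in> monoid_epi M F" "\<psi> \<in> monoid_epi N F"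
  shows "submonoid (carrier (fiber_product M N \<phi> \<psi>)) (M \<times>\<times> N)"
proof -
  interpret M: monoid M by fact
  interpret N: monoid N by fact
  show ?thesis
    using assms(3,4)
    by unfold_locales (auto simp: fiber_product_def monoid_epi_def epi_def hom_def)
qed

end

theory Submission
  imports Defs "HOL-Algebra.Multiplicative_Group"
begin

text \<open>
  Since the alphabets are finite, the fiber product is finitely generated exactly if the pairs of
  words of length at most \<open>N\<close> generate it for some bound \<open>N\<close>. So non-generation is shown by a proper
  submonoid that contains all short pairs.

  If the common images of the letters are \<open>x\<close> and \<open>y\<close>, then \<open>\<phi> u = x\<^bsup>|u|\<^esup>\<close> and \<open>\<psi> v = y\<^bsup>|v|\<^esup>\<close>. In a
  group of order \<open>n\<close> a block of \<open>n\<close> letters has value \<open>\<one>\<close>, hence can be split off either component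
  of a pair, and the pairs of length at most \<open>n\<close> generate.

  Conversely, let pairs of length at most \<open>N\<close> generate; there are three steps.

  Every \<open>g = \<phi> a\<close> with \<open>a \<in> A\<close> is a unit (\<open>letter_power_eq_one_if_fg\<close>). Otherwise no positive power
  of \<open>g\<close> is \<open>\<one>\<close>, so a generator \<open>(a\<^sup>i, v)\<close> with \<open>i > 0\<close> has \<open>v\<close> nonempty, and \<open>(a\<^sup>k, v)\<close> in the fiber
  product forces \<open>k \<le> N |v|\<close>. As \<open>F\<close> is finite, every \<open>g\<^sup>k\<close> is \<open>\<psi> v\<close> for some \<open>v\<close> from a finite set,
  which is absurd for large \<open>k\<close>. The images of the letters generate \<open>F\<close>, so \<open>F\<close> is a group.

  All letters of \<open>A\<close> have the same image (\<open>letters_same_image_if_fg\<close>). If \<open>\<phi> a \<noteq> \<phi> b\<close>, then by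
  cancellation at least one of the two letters leads from any given element of \<open>F\<close> to an element
  other than \<open>\<one>\<close>, so there is a word of length \<open>N + 1\<close> all of whose nonempty prefixes avoid \<open>\<one>\<close>.
  It extends to a word \<open>u\<close> with \<open>\<phi> u = \<one>\<close>, and the first generator of \<open>(u, [])\<close> with a nonempty first component is impossible.
  By symmetry of the fiber product the same holds for \<open>B\<close>.

  Finally, a group generated by the single element \<open>\<phi> a\<close> is cyclic.
\<close>

section \<open>Generated submonoids and epimorphisms\<close>

lemma submonoid_carrier: "monoid M \<Longrightarrow> submonoid (carrier M) M"
  by unfold_locales (auto simp: monoid.m_closed)

lemma submonoid_generated_by_eq_carrierI:
  assumes "monoid M" "S \<subseteq> carrier M"
    and "\<And>H. \<lbrakk>submonoid H M; S \<subseteq> H\<rbrakk> \<Longrightarrow> carrier M \<subseteq> H"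
  shows "submonoid_generated_by M S = carrier M"
  using assms submonoid_carrier[OF assms(1)] unfolding submonoid_generated_by_def by blast

lemma carrier_subset_if_generated:
  assumes "submonoid_generated_by M S = carrier M" "submonoid H M" "S \<subseteq> H"
  shows "carrier M \<subseteq> H"
  using assms unfolding submonoid_generated_by_def by blast

lemma finitely_generated_monoid_epimorphic_image:
  assumes "monoid M" "monoid N" "h \<in> monoid_epi M N" "finitely_generated_monoid M"
  shows "finitely_generated_monoid N"
proof -
  interpret M: monoid M by fact
  interpret N: monoid N by fact
  obtain S where S: "finite S" "S \<subseteq> carrier M" "submonoid_generated_by M S = carrier M"
    using assms(4) by (auto simp only: finitely_generated_monoid_def)
  have "h \<in> hom M N" and h1: "h \<one>\<^bsub>M\<^esub> = \<one>\<^bsub>N\<^esub>" and surj: "h ` carrier M = carrier N"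
    using assms(3) by (simp_all add: monoid_epi_def epi_def)
  note h = hom_in_carrier[OF this(1)] hom_mult[OF this(1)]
  have "submonoid_generated_by N (h ` S) = carrier N"
  proof (rule submonoid_generated_by_eq_carrierI[OF N.monoid_axioms])
    show "h ` S \<subseteq> carrier N" using h(1) S(2) by blast
    fix H assume H: "submonoid H N" "h ` S \<subseteq> H"
    interpret H: submonoid H N by fact
    have "submonoid {x \<in> carrier M. h x \<in> H} M"
    proof (rule submonoid.intro)
      fix x y assume "x \<in> {x \<in> carrier M. h x \<in> H}" "y \<in> {x \<in> carrier M. h x \<in> H}"
      then show "x \<otimes>\<^bsub>M\<^esub> y \<in> {x \<in> carrier M. h x \<in> H}" using h(2) by simp
    qed (use h1 in auto)
    moreover have "S \<subseteq> {x \<in> carrier M. h x \<in> H}" using S(2) H(2) by blast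
    ultimately have "carrier M \<subseteq> {x \<in> carrier M. h x \<in> H}"
      using carrier_subset_if_generated[OF S(3)] by blast
    then have "h ` carrier M \<subseteq> H" by auto
    then show "carrier N \<subseteq> H" by (simp add: surj)
  qed
  moreover have "h ` S \<subseteq> carrier N" using h(1) S(2) by blast
  ultimately show ?thesis
    using S(1) unfolding finitely_generated_monoid_def by (intro exI[of _ "h ` S"]) simp
qed

lemma monoid_epi_free_monoidD:
  assumes "\<phi> \<in> monoid_epi (free_monoid A) F"
  shows "\<phi> [] = \<one>\<^bsub>F\<^esub>"
    and "u \<in> lists A \<Longrightarrow> \<phi> u \<in> carrier F"
    and "\<lbrakk>u \<in> lists A; v \<in> lists A\<rbrakk> \<Longrightarrow> \<phi> (u @ v) = \<phi> u \<otimes>\<^bsub>F\<^esub> \<phi> v"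
    and "x \<in> carrier F \<Longrightarrow> \<exists>u \<in> lists A. \<phi> u = x"
proof -
  have \<phi>: "\<phi> \<in> hom (free_monoid A) F" "\<phi> [] = \<one>\<^bsub>F\<^esub>" "\<phi> ` lists A = carrier F"
    using assms by (auto simp: monoid_epi_def epi_def)
  show "\<phi> [] = \<one>\<^bsub>F\<^esub>" by (rule \<phi>(2))
  show "\<phi> u \<in> carrier F" if "u \<in> lists A"
    using \<phi>(3) that by blast
  show "\<phi> (u @ v) = \<phi> u \<otimes>\<^bsub>F\<^esub> \<phi> v" if "u \<in> lists A" "v \<in> lists A"
    using hom_mult[OF \<phi>(1)] that by simp
  show "\<exists>u \<in> lists A. \<phi> u = x" if "x \<in> carrier F"
    using \<phi>(3) that by (metis imageE)
qed

lemma monoid_epi_constant_letters: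
  assumes "monoid F" "\<phi> \<in> monoid_epi (free_monoid A) F"
    and "C \<subseteq> A" "\<And>a. a \<in> C \<Longrightarrow> \<phi> [a] = x" "u \<in> lists C"
  shows "\<phi> u = x [^]\<^bsub>F\<^esub> length u"
  using assms(5)
proof (induction u rule: rev_induct)
  case Nil
  then show ?case using monoid_epi_free_monoidD(1)[OF assms(2)] by simp
next
  case (snoc c u)
  then have "\<phi> (u @ [c]) = \<phi> u \<otimes>\<^bsub>F\<^esub> \<phi> [c]"
    using assms(3) by (intro monoid_epi_free_monoidD(3)[OF assms(2)]) auto
  then show ?case using snoc assms(4) by simp
qed

section \<open>Fiber products of free monoids\<close>

lemma fiber_product_free_simps:
  "(u, v) \<in> carrier (fiber_product (free_monoid A) (free_monoid B) \<phi> \<psi>) \<longleftrightarrow>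
    u \<in> lists A \<and> v \<in> lists B \<and> \<phi> u = \<psi> v"
  "(u, v) \<otimes>\<^bsub>fiber_product (free_monoid A) (free_monoid B) \<phi> \<psi>\<^esub> (u', v') = (u @ u', v @ v')"
  "\<one>\<^bsub>fiber_product (free_monoid A) (free_monoid B) \<phi> \<psi>\<^esub> = ([], [])"
  by (auto simp: fiber_product_def DirProd_def)

lemma monoid_fiber_product:
  assumes "monoid M" "monoid N" "\<phi> \<in> monoid_epi M F" "\<psi> \<in> monoid_epi N F"
  shows "monoid (fiber_product M N \<phi> \<psi>)"
  using submonoid.submonoid_is_monoid[OF submonoid_fiber_product[OF assms]
      DirProd_monoid[OF assms(1,2)]]
  by (simp add: fiber_product_def)

lemma finitely_generated_fiber_product_swap:
  assumes "monoid M" "monoid N" "\<phi> \<in> monoid_epi M F" "\<psi> \<in> monoid_epi N F"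
    and "finitely_generated_monoid (fiber_product M N \<phi> \<psi>)"
  shows "finitely_generated_monoid (fiber_product N M \<psi> \<phi>)"
proof (rule finitely_generated_monoid_epimorphic_image[OF _ _ _ assms(5)])
  show "prod.swap \<in> monoid_epi (fiber_product M N \<phi> \<psi>) (fiber_product N M \<psi> \<phi>)"
    by (auto simp: monoid_epi_def epi_def hom_def fiber_product_def image_iff)
  show "monoid (fiber_product M N \<phi> \<psi>)" by (rule monoid_fiber_product[OF assms(1-4)])
  show "monoid (fiber_product N M \<psi> \<phi>)"
    by (rule monoid_fiber_product[OF assms(2,1,4,3)])
qed

locale free_fiber_product =
  fixes A :: "'a set" and B :: "'b set" and F :: "('f, 'c) monoid_scheme" (structure)
    and \<phi> :: "'a list \<Rightarrow> 'f" and \<psi> :: "'b list \<Rightarrow> 'f"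
  assumes finite_A: "finite A" and finite_B: "finite B"
    and monoid_F: "monoid F"
    and epi_\<phi>: "\<phi> \<in> monoid_epi (free_monoid A) F"
    and epi_\<psi>: "\<psi> \<in> monoid_epi (free_monoid B) F"
begin

sublocale F: monoid F by (rule monoid_F)

lemmas \<phi>D = monoid_epi_free_monoidD[OF epi_\<phi>]
lemmas \<psi>D = monoid_epi_free_monoidD[OF epi_\<psi>]

abbreviation FP where "FP \<equiv> fiber_product (free_monoid A) (free_monoid B) \<phi> \<psi>"

definition short_pairs :: "nat \<Rightarrow> ('a list \<times> 'b list) set" where
  "short_pairs N = {(u, v) \<in> carrier FP. length u \<le> N \<and> length v \<le> N}"

text \<open>Finite generating sets can be enlarged to all pairs up to some length, which turns finite
  generation into a statement about a single number. This is where the alphabets must be finite.\<close>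

lemma finitely_generated_iff_short_pairs:
  "finitely_generated_monoid FP \<longleftrightarrow> (\<exists>N. submonoid_generated_by FP (short_pairs N) = carrier FP)"
proof
  have mon: "monoid FP"
    by (rule monoid_fiber_product[OF monoid_free_monoid monoid_free_monoid epi_\<phi> epi_\<psi>])
  assume "finitely_generated_monoid FP"
  then obtain S where S: "finite S" "S \<subseteq> carrier FP" "submonoid_generated_by FP S = carrier FP"
    by (auto simp: finitely_generated_monoid_def)
  define N where "N = Max (insert 0 ((\<lambda>(u, v). max (length u) (length v)) ` S))"
  have "S \<subseteq> short_pairs N"
  proof
    fix p assume p: "p \<in> S"
    obtain u v where uv: "p = (u, v)" by fastforce
    have "max (length u) (length v) \<in> (\<lambda>(u, v). max (length u) (length v)) ` S"
      using p uv by force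
    then have "max (length u) (length v) \<le> N"
      unfolding N_def using S(1) by (intro Max_ge) auto
    then show "p \<in> short_pairs N"
      using p S(2) uv by (auto simp: short_pairs_def)
  qed
  then have "submonoid_generated_by FP (short_pairs N) = carrier FP"
    using carrier_subset_if_generated[OF S(3)]
    by (intro submonoid_generated_by_eq_carrierI[OF mon]) (auto simp: short_pairs_def)
  then show "\<exists>N. submonoid_generated_by FP (short_pairs N) = carrier FP" ..
next
  assume "\<exists>N. submonoid_generated_by FP (short_pairs N) = carrier FP"
  then obtain N where N: "submonoid_generated_by FP (short_pairs N) = carrier FP" ..
  have "short_pairs N \<subseteq>
      {u. set u \<subseteq> A \<and> length u \<le> N} \<times> {v. set v \<subseteq> B \<and> length v \<le> N}"
    by (auto simp: short_pairs_def fiber_product_free_simps)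
  then have "finite (short_pairs N)"
    by (rule finite_subset)
       (intro finite_cartesian_product finite_lists_length_le finite_A finite_B)
  moreover have "short_pairs N \<subseteq> carrier FP" by (auto simp: short_pairs_def)
  ultimately show "finitely_generated_monoid FP"
    using N unfolding finitely_generated_monoid_def by blast
qed

text \<open>The submonoids that witness missing generators below all have this shape.\<close>

lemma submonoid_fiber_product_Collect:
  assumes "P [] []"
    and "\<And>u v u' v'. \<lbrakk>P u v; P u' v'\<rbrakk> \<Longrightarrow> P (u @ u') (v @ v')"
  shows "submonoid {(u, v) \<in> carrier FP. P u v} FP"
  by unfold_locales
     (auto simp: assms fiber_product_free_simps in_lists_conv_set \<phi>D(1,3) \<psi>D(1,3))

section \<open>Necessity\<close>

text \<open>If no power of \<open>\<phi> a\<close> is \<open>\<one>\<close>, then generators force the second component of \<open>(a\<^sup>k, v)\<close> to grow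
  linearly in \<open>k\<close>, whereas finiteness of \<open>F\<close> offers a partner \<open>v\<close> of bounded length.\<close>

lemma letter_power_eq_one_if_fg:
  assumes fg: "finitely_generated_monoid FP" and fin: "finite (carrier F)" and a: "a \<in> A"
  shows "\<exists>i>0. \<phi> [a] [^] (i::nat) = \<one>"
proof (rule ccontr)
  assume "\<not> ?thesis"
  then have no: "\<phi> [a] [^] i \<noteq> \<one>" if "i > 0" for i :: nat using that by blast
  have pow: "\<phi> u = \<phi> [a] [^] length u" if "u \<in> lists {a}" for u
    using monoid_epi_constant_letters[OF monoid_F epi_\<phi>, of "{a}" "\<phi> [a]" u] a that by auto
  obtain N where N: "submonoid_generated_by FP (short_pairs N) = carrier FP"
    using fg finitely_generated_iff_short_pairs by blast
  \<comment> \<open>Each short pair whose first component is a nonempty power of \<^term>\<open>a\<close> costs at least one letter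
    in the second component.\<close>
  define H where "H = {(u, v) \<in> carrier FP. u \<in> lists {a} \<longrightarrow> length u \<le> N * length v}"
  have "submonoid H FP"
    unfolding H_def
    by (rule submonoid_fiber_product_Collect) (auto simp: algebra_simps)
  moreover have "short_pairs N \<subseteq> H"
  proof
    fix p assume p: "p \<in> short_pairs N"
    obtain u v where uv: "p = (u, v)" by fastforce
    have mem: "(u, v) \<in> carrier FP" and len: "length u \<le> N"
      using p uv by (auto simp: short_pairs_def)
    have "length u \<le> N * length v" if u: "u \<in> lists {a}"
    proof (cases "v = []")
      case True
      then have "\<phi> [a] [^] length u = \<one>"
        using mem pow[OF u] \<psi>D(1) by (simp add: fiber_product_free_simps)
      then show ?thesis using no[of "length u"] by (cases "length u > 0") simp_all
    next
      case False
      then have "N \<le> N * length v" by (cases v) simp_all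
      then show ?thesis by (rule order_trans[OF len])
    qed
    then show "p \<in> H" using mem uv by (auto simp: H_def)
  qed
  ultimately have sub: "carrier FP \<subseteq> H" by (rule carrier_subset_if_generated[OF N])
  have "\<forall>x \<in> carrier F. \<exists>v. v \<in> lists B \<and> \<psi> v = x"
    using \<psi>D(4) by blast
  from bchoice[OF this] obtain w
    where w: "\<forall>x \<in> carrier F. w x \<in> lists B \<and> \<psi> (w x) = x" ..
  define M where "M = Max ((\<lambda>x. length (w x)) ` carrier F)"
  have M: "length (w x) \<le> M" if "x \<in> carrier F" for x
    unfolding M_def using fin that by (intro Max_ge) simp_all
  define u where "u = replicate (Suc (N * M)) a"
  have u: "u \<in> lists A" "u \<in> lists {a}" using a by (auto simp: u_def in_lists_conv_set)
  have \<phi>u: "\<phi> u \<in> carrier F" by (rule \<phi>D(2)[OF u(1)])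
  then have "(u, w (\<phi> u)) \<in> carrier FP"
    using w u(1) by (simp add: fiber_product_free_simps)
  then have "(u, w (\<phi> u)) \<in> H" by (rule subsetD[OF sub])
  then have "length u \<le> N * length (w (\<phi> u))" using u(2) by (simp add: H_def)
  also have "\<dots> \<le> N * M" by (intro mult_le_mono2 M \<phi>u)
  finally show False by (simp add: u_def)
qed

lemma group_if_fg:
  assumes fg: "finitely_generated_monoid FP" and fin: "finite (carrier F)"
  shows "group F"
proof -
  have unit: "\<phi> [a] \<in> Units F" if a: "a \<in> A" for a
  proof -
    obtain i where i: "i > 0" "\<phi> [a] [^] (i::nat) = \<one>"
      using letter_power_eq_one_if_fg[OF fg fin a] by blast
    obtain k where k: "i = Suc k" using i(1) gr0_conv_Suc by blast
    have c: "\<phi> [a] \<in> carrier F" using \<phi>D(2) a by simp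
    have "\<phi> [a] [^] k \<otimes> \<phi> [a] = \<one>" "\<phi> [a] \<otimes> \<phi> [a] [^] k = \<one>"
      using i(2) k c F.nat_pow_Suc2[OF c, of k] by simp_all
    then show ?thesis using c unfolding Units_def by blast
  qed
  have "\<phi> u \<in> Units F" if "u \<in> lists A" for u
    using that
  proof (induction u rule: rev_induct)
    case Nil
    then show ?case by (simp add: \<phi>D(1))
  next
    case (snoc a u)
    then show ?case using \<phi>D(3)[of u "[a]"] unit[of a] by simp
  qed
  then have "carrier F \<subseteq> Units F" using \<phi>D(4) by blast
  then show ?thesis by unfold_locales
qed

text \<open>Right multiplication by \<open>\<phi> a\<close> and by \<open>\<phi> b\<close> sends an element to two different places, of which
  at most one is \<open>\<one>\<close>; so a path in the Cayley graph can always be continued without meeting \<open>\<one>\<close>.\<close>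

lemma ex_word_prefixes_avoid_one:
  assumes "group F" and ab: "a \<in> A" "b \<in> A" "\<phi> [a] \<noteq> \<phi> [b]"
  shows "\<exists>w \<in> lists A. length w = k \<and> (\<forall>j. 0 < j \<and> j \<le> k \<longrightarrow> \<phi> (take j w) \<noteq> \<one>)"
proof (induction k)
  case 0
  then show ?case by (intro bexI[of _ "[]"]) auto
next
  case (Suc k)
  interpret G: group F by fact
  obtain w where w: "w \<in> lists A" "length w = k"
    "\<And>j. \<lbrakk>0 < j; j \<le> k\<rbrakk> \<Longrightarrow> \<phi> (take j w) \<noteq> \<one>"
    using Suc by blast
  have "\<phi> w \<otimes> \<phi> [a] \<noteq> \<phi> w \<otimes> \<phi> [b]"
    using ab \<phi>D(2) w(1) F.Units_l_cancel[of "\<phi> w" "\<phi> [a]" "\<phi> [b]"] by simp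
  then have "\<exists>c \<in> A. \<phi> w \<otimes> \<phi> [c] \<noteq> \<one>" using ab by metis
  then obtain c where c: "c \<in> A" "\<phi> (w @ [c]) \<noteq> \<one>" using \<phi>D(3) w(1) by auto
  have "\<phi> (take j (w @ [c])) \<noteq> \<one>" if "0 < j" "j \<le> Suc k" for j
    using that w(2,3) c(2) by (cases "j = Suc k") auto
  then show ?case using w c(1) by (intro bexI[of _ "w @ [c]"]) auto
qed

text \<open>Over the empty second component only pairs \<open>(u, [])\<close> with \<open>\<phi> u = \<one>\<close> can be multiplied. Hence the
  value of the prefixes of a product returns to \<open>\<one>\<close> as soon as the first factor has been read.\<close>

lemma letters_same_image_if_fg:
  assumes fg: "finitely_generated_monoid FP" and "group F" and ab: "a \<in> A" "b \<in> A"
  shows "\<phi> [a] = \<phi> [b]"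
proof (rule ccontr)
  assume ne: "\<phi> [a] \<noteq> \<phi> [b]"
  interpret G: group F by fact
  obtain N where N: "submonoid_generated_by FP (short_pairs N) = carrier FP"
    using fg finitely_generated_iff_short_pairs by blast
  define early_return where
    "early_return u \<longleftrightarrow> (\<exists>j. 0 < j \<and> j \<le> N \<and> j \<le> length u \<and> \<phi> (take j u) = \<one>)" for u
  have early_append: "early_return (u @ v)" if er: "early_return u" for u v
  proof -
    obtain j where "0 < j" "j \<le> N" "j \<le> length u" "\<phi> (take j u) = \<one>"
      using er unfolding early_return_def by blast
    then show ?thesis unfolding early_return_def by (intro exI[of _ j]) simp
  qed
  define H where "H = {(u, v) \<in> carrier FP. v = [] \<longrightarrow> u = [] \<or> early_return u}"
  have "submonoid H FP"
    unfolding H_def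
    by (rule submonoid_fiber_product_Collect) (auto simp: early_append)
  moreover have "short_pairs N \<subseteq> H"
  proof
    fix p assume p: "p \<in> short_pairs N"
    obtain u v where uv: "p = (u, v)" by fastforce
    have mem: "(u, v) \<in> carrier FP" and len: "length u \<le> N"
      using p uv by (auto simp: short_pairs_def)
    \<comment> \<open>A short nonempty \<^term>\<open>u\<close> over the empty word returns to \<^term>\<open>\<one>\<close> at its own end.\<close>
    have "early_return u" if "v = []" "u \<noteq> []"
    proof -
      have "\<phi> (take (length u) u) = \<one>"
        using mem that(1) \<psi>D(1) by (simp add: fiber_product_free_simps)
      then show ?thesis
        using len that(2) unfolding early_return_def by (intro exI[of _ "length u"]) simp
    qed
    then show "p \<in> H" using mem uv by (auto simp: H_def)
  qed
  ultimately have sub: "carrier FP \<subseteq> H" by (rule carrier_subset_if_generated[OF N])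
  obtain w where w: "w \<in> lists A" "length w = Suc N"
    "\<And>j. \<lbrakk>0 < j; j \<le> Suc N\<rbrakk> \<Longrightarrow> \<phi> (take j w) \<noteq> \<one>"
    using ex_word_prefixes_avoid_one[OF \<open>group F\<close> ab ne, of "Suc N"] by blast
  obtain z where z: "z \<in> lists A" "\<phi> z = inv (\<phi> w)"
    using \<phi>D(4)[OF G.inv_closed[OF \<phi>D(2)[OF w(1)]]] by blast
  have "\<phi> (w @ z) = \<one>" using w(1) z \<phi>D(2,3) by simp
  then have "(w @ z, []) \<in> carrier FP"
    using w(1) z(1) \<psi>D(1) by (simp add: fiber_product_free_simps)
  then have "(w @ z, []) \<in> H" by (rule subsetD[OF sub])
  then have "early_return (w @ z)" using w(2) by (auto simp: H_def)
  then obtain j where "0 < j" "j \<le> N" "\<phi> (take j (w @ z)) = \<one>"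
    by (auto simp: early_return_def)
  then show False using w(2) w(3)[of j] by simp
qed

section \<open>Sufficiency\<close>

text \<open>The value of a word depends on its length alone, and a block of \<open>|F|\<close> letters has value \<open>\<one>\<close>. So
  such a block, paired with the empty word, is itself in the fiber product and can be split off.\<close>

lemma fg_if_constant_letters_group:
  assumes "group F" and fin: "finite (carrier F)"
    and x: "x \<in> carrier F" "\<And>a. a \<in> A \<Longrightarrow> \<phi> [a] = x"
    and y: "y \<in> carrier F" "\<And>b. b \<in> B \<Longrightarrow> \<psi> [b] = y"
  shows "finitely_generated_monoid FP"
proof -
  interpret G: group F by fact
  define n where "n = order F"
  have n: "n > 0" using fin F.order_gt_0_iff_finite by (simp add: n_def)
  have \<phi>1: "\<phi> u = \<one>" if "u \<in> lists A" "length u = n" for u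
    using monoid_epi_constant_letters[OF monoid_F epi_\<phi> order_refl x(2) that(1)] that(2)
      G.pow_order_eq_1[OF x(1)] by (simp add: n_def)
  have \<psi>1: "\<psi> v = \<one>" if "v \<in> lists B" "length v = n" for v
    using monoid_epi_constant_letters[OF monoid_F epi_\<psi> order_refl y(2) that(1)] that(2)
      G.pow_order_eq_1[OF y(1)] by (simp add: n_def)
  have gen: "(u, v) \<in> H"
    if H: "submonoid H FP" "short_pairs n \<subseteq> H" and "(u, v) \<in> carrier FP" for H u v
    using that(3)
  proof (induction "length u + length v" arbitrary: u v rule: less_induct)
    case less
    interpret H: submonoid H FP by fact
    have uv: "u \<in> lists A" "v \<in> lists B" "\<phi> u = \<psi> v"
      using less.prems by (auto simp: fiber_product_free_simps)
    consider "length u > n" | "length v > n" | "length u \<le> n" "length v \<le> n" by linarith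
    then show ?case
    proof cases
      case 1
      let ?p = "take n u" and ?q = "drop n u"
      have pq: "?p \<in> lists A" "?q \<in> lists A" "length ?p = n"
        using uv(1) append_in_lists_conv[of ?p ?q A] 1 by simp_all
      have "\<phi> u = \<phi> ?q"
        using \<phi>D(3)[OF pq(1,2)] \<phi>1[OF pq(1,3)] \<phi>D(2)[OF pq(2)] by simp
      then have "(?q, v) \<in> carrier FP" using pq(2) uv by (simp add: fiber_product_free_simps)
      then have "(?q, v) \<in> H" using less.hyps[of ?q v] 1 n by simp
      moreover have "(?p, []) \<in> short_pairs n"
        using pq \<phi>1 \<psi>D(1) by (simp add: short_pairs_def fiber_product_free_simps)
      then have "(?p, []) \<in> H" by (rule subsetD[OF H(2)])
      ultimately have "(?p, []) \<otimes>\<^bsub>FP\<^esub> (?q, v) \<in> H" by (intro H.m_closed)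
      then show ?thesis by (simp add: fiber_product_free_simps)
    next
      case 2
      let ?p = "take n v" and ?q = "drop n v"
      have pq: "?p \<in> lists B" "?q \<in> lists B" "length ?p = n"
        using uv(2) append_in_lists_conv[of ?p ?q B] 2 by simp_all
      have "\<psi> v = \<psi> ?q"
        using \<psi>D(3)[OF pq(1,2)] \<psi>1[OF pq(1,3)] \<psi>D(2)[OF pq(2)] by simp
      then have "(u, ?q) \<in> carrier FP" using pq(2) uv by (simp add: fiber_product_free_simps)
      then have "(u, ?q) \<in> H" using less.hyps[of u ?q] 2 n by simp
      moreover have "([], ?p) \<in> short_pairs n"
        using pq \<psi>1 \<phi>D(1) by (simp add: short_pairs_def fiber_product_free_simps)
      then have "([], ?p) \<in> H" by (rule subsetD[OF H(2)])
      ultimately have "([], ?p) \<otimes>\<^bsub>FP\<^esub> (u, ?q) \<in> H" by (intro H.m_closed)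
      then show ?thesis by (simp add: fiber_product_free_simps)
    next
      case 3
      then show ?thesis using less.prems H(2) by (auto simp: short_pairs_def)
    qed
  qed
  have mon: "monoid FP"
    by (rule monoid_fiber_product[OF monoid_free_monoid monoid_free_monoid epi_\<phi> epi_\<psi>])
  have "submonoid_generated_by FP (short_pairs n) = carrier FP"
  proof (rule submonoid_generated_by_eq_carrierI[OF mon])
    show "short_pairs n \<subseteq> carrier FP" by (auto simp: short_pairs_def)
    show "carrier FP \<subseteq> H" if "submonoid H FP" "short_pairs n \<subseteq> H" for H
      by (rule subrelI) (rule gen[OF that])
  qed
  then show ?thesis using finitely_generated_iff_short_pairs by blast
qed

end

section \<open>The characterization\<close>

lemma cyclic_group_if_constant_letters:
  assumes "group F" "\<phi> \<in> monoid_epi (free_monoid A) F"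
    and a: "a \<in> A" and const: "\<And>b. b \<in> A \<Longrightarrow> \<phi> [b] = \<phi> [a]"
  shows "cyclic_group F"
proof -
  interpret group F by fact
  have x: "\<phi> [a] \<in> carrier F" using monoid_epi_free_monoidD(2)[OF assms(2)] a by simp
  have "y \<in> range (\<lambda>n::int. \<phi> [a] [^]\<^bsub>F\<^esub> n)" if "y \<in> carrier F" for y
  proof -
    obtain u where "u \<in> lists A" "\<phi> u = y"
      using monoid_epi_free_monoidD(4)[OF assms(2) \<open>y \<in> carrier F\<close>] by blast
    then have "y = \<phi> [a] [^]\<^bsub>F\<^esub> int (length u)"
      using monoid_epi_constant_letters[OF monoid_axioms assms(2) order_refl const]
      by (simp add: int_pow_int)
    then show ?thesis by blast
  qed
  then show ?thesis using x unfolding cyclic_group by auto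
qed

lemma card_image_eq_1_iff:
  "card (f ` A) = 1 \<longleftrightarrow> A \<noteq> {} \<and> (\<forall>a\<in>A. \<forall>b\<in>A. f a = f b)"
proof
  assume "card (f ` A) = 1"
  then obtain y where "f ` A = {y}" using card_1_singletonE by blast
  then have "A \<noteq> {}" "\<forall>a\<in>A. f a = y" by auto
  then show "A \<noteq> {} \<and> (\<forall>a\<in>A. \<forall>b\<in>A. f a = f b)" by simp
next
  assume *: "A \<noteq> {} \<and> (\<forall>a\<in>A. \<forall>b\<in>A. f a = f b)"
  then obtain a where "a \<in> A" by blast
  then have "f ` A = {f a}" using * by blast
  then show "card (f ` A) = 1" by simp
qed

theorem theorem3p4:
  fixes A :: "'a set" and B :: "'b set" and F :: "'f monoid"
    and \<phi> :: "'a list \<Rightarrow> 'f" and \<psi> :: "'b list \<Rightarrow> 'f"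
  assumes "finite A" and "A \<noteq> {}" and "finite B" and "B \<noteq> {}"
    and "monoid F" and "finite (carrier F)"
    and "\<phi> \<in> monoid_epi (free_monoid A) F"
    and "\<psi> \<in> monoid_epi (free_monoid B) F"
  shows "finitely_generated_monoid (fiber_product (free_monoid A) (free_monoid B) \<phi> \<psi>) \<longleftrightarrow>
    card ((\<lambda>a. \<phi> [a]) ` A) = 1 \<and> card ((\<lambda>b. \<psi> [b]) ` B) = 1 \<and> group F \<and> cyclic_group F"
proof -
  interpret AB: free_fiber_product A B F \<phi> \<psi>
    using assms by (intro free_fiber_product.intro)
  interpret BA: free_fiber_product B A F \<psi> \<phi>
    using assms by (intro free_fiber_product.intro)
  obtain a b where ab: "a \<in> A" "b \<in> B" using assms(2,4) by blast
  show ?thesis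
  proof (intro iffI conjI; (elim conjE)?)
    assume fg: "finitely_generated_monoid AB.FP"
    then have fg': "finitely_generated_monoid BA.FP"
      by (rule finitely_generated_fiber_product_swap
          [OF monoid_free_monoid monoid_free_monoid assms(7,8)])
    show G: "group F" by (rule AB.group_if_fg[OF fg assms(6)])
    note const_\<phi> = AB.letters_same_image_if_fg[OF fg G]
    note const_\<psi> = BA.letters_same_image_if_fg[OF fg' G]
    show "card ((\<lambda>a. \<phi> [a]) ` A) = 1"
      using assms(2) const_\<phi> unfolding card_image_eq_1_iff by blast
    show "card ((\<lambda>b. \<psi> [b]) ` B) = 1"
      using assms(4) const_\<psi> unfolding card_image_eq_1_iff by blast
    show "cyclic_group F"
      by (rule cyclic_group_if_constant_letters[OF G assms(7) ab(1)]) (rule const_\<phi>[OF _ ab(1)])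
  next
    assume c: "card ((\<lambda>a. \<phi> [a]) ` A) = 1" "card ((\<lambda>b. \<psi> [b]) ` B) = 1" "group F"
    show "finitely_generated_monoid AB.FP"
    proof (rule AB.fg_if_constant_letters_group[OF c(3) assms(6)])
      show "\<phi> [a] \<in> carrier F" "\<psi> [b] \<in> carrier F"
        using ab AB.\<phi>D(2) AB.\<psi>D(2) by auto
      show "\<phi> [a'] = \<phi> [a]" if "a' \<in> A" for a'
        using c(1) that ab(1) unfolding card_image_eq_1_iff by blast
      show "\<psi> [b'] = \<psi> [b]" if "b' \<in> B" for b'
        using c(2) that ab(2) unfolding card_image_eq_1_iff by blast
    qed
  qed
qed

end
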